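(* Consider the system $$\dot{\mathbf{\Delta V}}=-\mathbb{Q}\,\mathbf{\Delta V}-\mathbb{L}D\,\mathbf{I_L}-\mathbb{Q}\,\mathbf{V_{ref}},\qquad \mathbb{Q}=\mathbb{L}D\mathbb{M},$$ with constant inputs $\mathbf{I_L}=\mathbf{I_L^*}\in\mathbb{R}^N$ and $\mathbf{V_{ref}}=\mathbf{V_{ref}^*}\in\mathbb{R}^N$. Then current sharing is achieved at steady state: at every equilibrium $\mathbf{\Delta V^*}$, the corresponding output currents $\mathbf{I_t^*}=[I_{t1}^*,\dots,I_{tN}^*]^T$ satisfy $\frac{I_{ti}^*}{I_{ti}^s}=\frac{I_{tj}^*}{I_{tj}^s}$ for all $i,j\in\{1,\dots,N\}$. Moreover, writing the equilibrium as $\mathbf{\Delta V^*}=\mathbf{\widetilde{\Delta V}^*}+\alpha\mathbf{1}_N$, where $\mathbf{\widetilde{\Delta V}^*}$ is the unique equilibrium in $H^1$ and $\alpha\in\mathbb{R}$, if $\mathbf{V_{ref}^*}=V_{ref}\mathbf{1}_N$ for some $V_{ref}\in\mathbb{R}$ and $\alpha=0$, then the equilibrium voltage $\mathbf{V^*}=\mathbf{\Delta V^*}+\mathbf{V_{ref}^*}$ satisfies the voltage balancing condition $\langle\mathbf{V^*}\rangle=V_{ref}$.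
   Context: $\mathcal{G}_c$ is an undirected connected graph with node set $\{1,\dots,N\}$ and edge weights $a_{ij}=a_{ji}>0$; $\mathbb{L}=k_I\mathcal{L}(\mathcal{G}_c)$ with $k_I>0$ a constant. $\mathcal{G}_{el}$ is a weakly connected directed graph with the same node set, incidence matrix $B_{el}$ and diagonal matrix $W$ of positive edge weights; $\mathbb{M}=\mathcal{L}(\mathcal{G}_{el})=B_{el}WB_{el}^T$. The Laplacian of a weighted (di)graph with incidence matrix $B$ and diagonal matrix $W$ of edge weights is $\mathcal{L}=BWB^T$. $D=\mathrm{diag}\left(\frac1{I_{t1}^s},\dots,\frac1{I_{tN}^s}\right)$ with scaling factors $I_{ti}^s>0$. The system arises from the relations $\dot{\mathbf{\Delta V}}=-\mathbb{L}D\mathbf{I_t}$, $\mathbf{V}=\mathbf{\Delta V}+\mathbf{V_{ref}}$, line currents $\mathbf{I_\ell}=-WB_{el}^T\mathbf{V}$, and output currents $\mathbf{I_t}=\mathbf{I_L}-B_{el}\mathbf{I_\ell}$, i.e. $\mathbf{I_t}=\mathbf{I_L}+\mathbb{M}\mathbf{V}$. $\langle v\rangle=\frac1N\sum_i v_i$ and $H^1=\{v\in\mathbb{R}^N:\langle v\rangle=0\}$. It is known that the equilibria of the system for given constant inputs have the form $\mathbf{\widetilde{\Delta V}^*}+\alpha\mathbf{1}_N$ used in the claim. *)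

theory Defs
  imports "Graph_Theory.Digraph_Component" "HOL-Analysis.Analysis"
begin

text \<open>
  Vertices are the elements of a finite type \<open>'n\<close>; the number of nodes is \<open>CARD('n)\<close>.
  Edges are pairs of vertices, so edge-indexed vectors and matrices use the index type
  \<open>'n \<times> 'n\<close> and are zero at every pair that is not an arc of the graph at hand.
  This zero padding contributes nothing to the products below, and it keeps graphs without
  arcs (a single node) available.
\<close>

definition diag_mat :: "('k \<Rightarrow> real) \<Rightarrow> real ^ 'k ^ 'k" where
  "diag_mat d = (\<chi> i j. if i = j then d i else 0)"

text \<open>An arc enters its head (\<open>+1\<close>) and leaves its tail (\<open>-1\<close>).\<close>

definition incidence_mat :: "'n::finite pair_pre_digraph \<Rightarrow> real ^ ('n \<times> 'n) ^ 'n" where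
  "incidence_mat G = (\<chi> i e. if e \<in> parcs G
     then (if snd e = i then 1 else 0) - (if fst e = i then 1 else 0) else 0)"

definition weight_mat ::
    "'n::finite pair_pre_digraph \<Rightarrow> ('n \<times> 'n \<Rightarrow> real) \<Rightarrow> real ^ ('n \<times> 'n) ^ ('n \<times> 'n)" where
  "weight_mat G w = diag_mat (\<lambda>e. if e \<in> parcs G then w e else 0)"

definition laplacian ::
    "'n::finite pair_pre_digraph \<Rightarrow> ('n \<times> 'n \<Rightarrow> real) \<Rightarrow> real ^ 'n ^ 'n" where
  "laplacian G w = incidence_mat G ** weight_mat G w ** transpose (incidence_mat G)"

text \<open>
  An undirected graph is a symmetric digraph, in which every edge \<open>{i, j}\<close> appears as the two
  arcs \<open>(i, j)\<close> and \<open>(j, i)\<close>. Its incidence matrix has a single column per edge, so it is formed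
  from an orientation of the graph, which keeps exactly one of the two arcs. The choice is
  arbitrary: flipping an arc changes the sign of a column of the incidence matrix and hence
  leaves the Laplacian unchanged.
\<close>

definition orientation_of :: "'n pair_pre_digraph \<Rightarrow> 'n pair_pre_digraph \<Rightarrow> bool" where
  "orientation_of H G \<longleftrightarrow> pverts H = pverts G
     \<and> parcs H \<union> (parcs H)\<inverse> = parcs G \<and> parcs H \<inter> (parcs H)\<inverse> = {}"

lemma orientation_exists:
  fixes G :: "'n::finite pair_pre_digraph"
  assumes "pair_graph G"
  shows "\<exists>H. orientation_of H G"
proof -
  interpret pair_graph G by fact
  obtain f :: "'n \<Rightarrow> nat" where f: "inj f"
    using finite_imp_inj_to_nat_seg[of "UNIV :: 'n set"] by auto
  have sy: "(j, i) \<in> parcs G" if "(i, j) \<in> parcs G" for i j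
    using that pair_sym_arcs by (auto simp: symmetric_def sym_def)
  have ir: "f i < f j \<or> f j < f i" if "(i, j) \<in> parcs G" for i j
    using pair_no_loops[OF that] f by (auto simp: inj_def) (metis nat_neq_iff)
  have "orientation_of \<lparr>pverts = pverts G, parcs = {(i, j) \<in> parcs G. f i < f j}\<rparr> G"
    unfolding orientation_of_def using sy ir by fastforce
  then show ?thesis ..
qed

definition mean :: "real ^ 'n \<Rightarrow> real" where
  "mean v = (\<Sum>i\<in>UNIV. v $ i) / real CARD('n)"

definition H1 :: "(real ^ 'n) set" where
  "H1 = {v. mean v = 0}"

definition line_currents ::
    "'n::finite pair_pre_digraph \<Rightarrow> ('n \<times> 'n \<Rightarrow> real) \<Rightarrow> real ^ 'n \<Rightarrow> real ^ ('n \<times> 'n)" where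
  "line_currents G w V = - ((weight_mat G w ** transpose (incidence_mat G)) *v V)"

definition output_currents ::
    "'n::finite pair_pre_digraph \<Rightarrow> ('n \<times> 'n \<Rightarrow> real) \<Rightarrow> real ^ 'n \<Rightarrow> real ^ 'n \<Rightarrow> real ^ 'n" where
  "output_currents G w I_L V = I_L - incidence_mat G *v line_currents G w V"

text \<open>
  The vector field of the system, for Laplacians \<open>L\<close>, \<open>M\<close>, the scaling matrix \<open>D\<close> and constant
  inputs, as a function of the state \<open>x\<close>.
\<close>

definition consensus_field ::
    "real ^ 'n ^ 'n \<Rightarrow> real ^ 'n ^ 'n \<Rightarrow> real ^ 'n ^ 'n \<Rightarrow> real ^ 'n \<Rightarrow> real ^ 'n
      \<Rightarrow> real ^ 'n \<Rightarrow> real ^ 'n::finite" where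
  "consensus_field L D M I_L V_ref x =
     (let Q = L ** D ** M in - (Q *v x) - (L ** D) *v I_L - Q *v V_ref)"

definition equilibrium :: "('a \<Rightarrow> 'a) \<Rightarrow> 'a::zero \<Rightarrow> bool" where
  "equilibrium f x \<longleftrightarrow> f x = 0"

end

theory Submission
  imports Defs
begin

text \<open>
  A Laplacian \<open>M\<close> of a connected graph satisfies \<open>y \<bullet> M x = \<Sum>\<^sub>e w\<^sub>e (\<delta>y)\<^sub>e (\<delta>x)\<^sub>e\<close>, where \<open>\<delta>x\<close> is the
  vector of differences along the arcs. Hence its kernel consists of the constant vectors and its
  range of the vectors with zero sum. The vector field is \<open>x \<mapsto> - L D (I\<^sub>L + M (x + V\<^sub>r\<^sub>e\<^sub>f))\<close>, so
  equilibria are the solutions of \<open>I\<^sub>L + M (x + V\<^sub>r\<^sub>e\<^sub>f) = c I\<^sup>s\<close> for a constant \<open>c\<close>, which is current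
  sharing. Summing the components determines \<open>c\<close>, and \<open>x\<close> is then determined up to a constant.
\<close>

lemma diag_mat_mult_component: "(diag_mat d *v x) $ k = d k * x $ k"
  by (simp add: diag_mat_def matrix_vector_mult_def if_distrib [of "\<lambda>u. u * _"] cong: if_cong)

lemma transpose_incidence_mult_component:
  "(transpose (incidence_mat G) *v x) $ e = (if e \<in> parcs G then x $ snd e - x $ fst e else 0)"
proof -
  \<comment> \<open>Splitting each incidence entry into two indicators lets the sum over the
    vertices collapse to the head and tail terms.\<close>
  have "((if a then 1 else 0) - (if b then 1 else 0)) * t = (if a then t else 0) - (if b then t else 0)"
    for a b and t :: real
    by simp
  then show ?thesis
    by (simp add: transpose_def incidence_mat_def matrix_vector_mult_def sum_subtractf)
qed

text \<open>The left factor \<open>B\<close> of the Laplacian crosses the inner product as its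
  transpose, and the diagonal weight matrix then pairs the two difference vectors arc by
  arc.\<close>

lemma inner_laplacian:
  "y \<bullet> (laplacian G w *v x) =
    (\<Sum>e\<in>parcs G. w e * ((y $ snd e - y $ fst e) * (x $ snd e - x $ fst e)))"
proof -
  let ?B = "incidence_mat G"
  have "y \<bullet> (laplacian G w *v x) = y \<bullet> (?B *v (weight_mat G w *v (transpose ?B *v x)))"
    by (simp add: laplacian_def matrix_vector_mul_assoc matrix_mul_assoc
        del: transpose_matrix_vector)
  also have "\<dots> = (transpose ?B *v y) \<bullet> (weight_mat G w *v (transpose ?B *v x))"
    by (simp add: dot_lmul_matrix)
  also have "\<dots> = (\<Sum>e\<in>UNIV. if e \<in> parcs G
      then w e * ((y $ snd e - y $ fst e) * (x $ snd e - x $ fst e)) else 0)"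
    unfolding inner_vec_def weight_mat_def
    by (intro sum.cong refl)
      (simp add: diag_mat_mult_component transpose_incidence_mult_component
        del: transpose_matrix_vector)
  finally show ?thesis
    by (simp add: sum.If_cases)
qed

lemma vec_one_inner: "vec 1 \<bullet> (x :: real ^ 'n::finite) = (\<Sum>i\<in>UNIV. x $ i)"
  by (simp add: inner_vec_def)

text \<open>The test vector \<open>vec 1\<close> has no differences along arcs.\<close>

lemma sum_laplacian_mult: "(\<Sum>i\<in>UNIV. (laplacian G w *v x) $ i) = 0"
  unfolding vec_one_inner [symmetric] inner_laplacian by simp

text \<open>On a kernel vector the quadratic form is a vanishing sum of nonnegative terms, so every
  arc joins equal values. Equality passes along arcs in either direction, hence weak connectivity
  suffices.\<close>

lemma laplacian_mult_eq_zero_iff: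
  fixes G :: "'n::finite pair_pre_digraph"
  assumes conn: "\<And>i j. (i, j) \<in> (parcs G \<union> (parcs G)\<inverse>)\<^sup>*"
    and pos: "\<And>e. e \<in> parcs G \<Longrightarrow> w e > 0"
  shows "laplacian G w *v x = 0 \<longleftrightarrow> (\<exists>c. \<forall>i. x $ i = c)"
proof
  assume "laplacian G w *v x = 0"
  then have "(\<Sum>e\<in>parcs G. w e * ((x $ snd e - x $ fst e) * (x $ snd e - x $ fst e))) = 0"
    by (simp flip: inner_laplacian)
  then have "\<forall>e\<in>parcs G. w e * ((x $ snd e - x $ fst e) * (x $ snd e - x $ fst e)) = 0"
    by (subst (asm) sum_nonneg_eq_0_iff) (auto simp: pos less_imp_le)
  then have step: "x $ snd e = x $ fst e" if "e \<in> parcs G" for e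
    using that pos [OF that] by auto
  have "x $ i = x $ j" if "(i, j) \<in> (parcs G \<union> (parcs G)\<inverse>)\<^sup>*" for i j
    using that by induction (auto dest: step)
  then show "\<exists>c. \<forall>i. x $ i = c"
    using conn by blast
next
  assume "\<exists>c. \<forall>i. x $ i = c"
  \<comment> \<open>A vector orthogonal to every \<open>y\<close>, in particular to itself, is
    zero.\<close>
  then have "y \<bullet> (laplacian G w *v x) = 0" for y
    by (auto simp: inner_laplacian)
  then show "laplacian G w *v x = 0"
    using inner_eq_zero_iff by blast
qed

lemma laplacian_surj_zero_sum:
  fixes G :: "'n::finite pair_pre_digraph"
  assumes conn: "\<And>i j. (i, j) \<in> (parcs G \<union> (parcs G)\<inverse>)\<^sup>*"
    and pos: "\<And>e. e \<in> parcs G \<Longrightarrow> w e > 0"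
    and b: "(\<Sum>i\<in>UNIV. b $ i) = 0"
  obtains x where "laplacian G w *v x = b"
proof -
  \<comment> \<open>This rank-one perturbation makes the Laplacian invertible.\<close>
  define f where "f x = laplacian G w *v x + (\<Sum>i\<in>UNIV. x $ i) *\<^sub>R vec 1" for x
  \<comment> \<open>The Laplacian part has zero sum, so only the rank-one part is seen here. Thus
    \<open>f x\<close> has zero sum exactly when \<open>x\<close> has, and on such \<open>x\<close>
    the map \<open>f\<close> agrees with the Laplacian.\<close>
  have sum_f: "(\<Sum>i\<in>UNIV. f x $ i) = real CARD('n) * (\<Sum>i\<in>UNIV. x $ i)" for x
    by (simp add: f_def sum.distrib sum_laplacian_mult)
  have "linear f"
    unfolding f_def
    by (intro linearI) (simp_all add: matrix_vector_right_distrib matrix_vector_mult_scaleR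
        sum.distrib algebra_simps flip: sum_distrib_left)
  moreover have "inj f"
  proof (rule linear_injective_0 [OF \<open>linear f\<close>, THEN iffD2], intro allI impI)
    fix x assume "f x = 0"
    then have s: "(\<Sum>i\<in>UNIV. x $ i) = 0"
      using sum_f [of x] by simp
    with \<open>f x = 0\<close> have "laplacian G w *v x = 0"
      by (simp add: f_def)
    then obtain c where "\<forall>i. x $ i = c"
      using laplacian_mult_eq_zero_iff [of G w x, OF conn pos] by blast
    with s show "x = 0"
      by (simp add: vec_eq_iff)
  qed
  ultimately have "surj f"
    by (rule linear_injective_imp_surjective) simp
  then obtain x where x: "f x = b"
    by (metis surjD)
  with b have "(\<Sum>i\<in>UNIV. x $ i) = 0"
    using sum_f [of x] by simp
  with x show thesis
    by (intro that [of x]) (simp add: f_def)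
qed

text \<open>Connectedness is strong connectedness of the symmetric closure; with all of
  \<open>UNIV\<close> as vertex set, the restricted closure \<open>rtrancl_on\<close> is the
  ordinary one.\<close>

lemma connected_imp_rtrancl:
  assumes "Digraph_Component.connected (with_proj G)" "pverts G = UNIV"
  shows "(i, j) \<in> (parcs G \<union> (parcs G)\<inverse>)\<^sup>*"
proof -
  have "(i, j) \<in> rtrancl_on UNIV (parcs (mk_symmetric (with_proj G)))"
    using assms by (simp add: Digraph_Component.connected_def strongly_connected_def reachable_def)
  moreover have "parcs (mk_symmetric (with_proj G)) = parcs G \<union> (parcs G)\<inverse>"
    by (auto simp: parcs_mk_symmetric)
  ultimately show ?thesis
    by (metis rtrancl_on_rtranclI)
qed

lemma output_currents_eq: "output_currents G w I V = I + laplacian G w *v V"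
  by (simp add: output_currents_def line_currents_def laplacian_def vec.neg
      matrix_vector_mul_assoc matrix_mul_assoc)

text \<open>All terms share the factor \<open>L ** D\<close>; for the electrical Laplacian
  \<open>M\<close>, what it acts on is the output current at voltage \<open>x + V\<close>.\<close>

lemma consensus_field_eq:
  "consensus_field L D M I V x = - (L *v (D *v (I + M *v (x + V))))"
  by (simp add: consensus_field_def Let_def matrix_vector_right_distrib
      flip: matrix_vector_mul_assoc)

lemma mean_add: "mean (x + y) = mean x + mean y"
  by (simp add: mean_def sum.distrib add_divide_distrib)

lemma mean_scaleR_vec_one: "mean (c *\<^sub>R vec 1 :: real ^ 'n::finite) = c"
  by (simp add: mean_def)


theorem proposition5:
  fixes G\<^sub>c O\<^sub>c G\<^sub>e\<^sub>l :: "'n::finite pair_pre_digraph"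
    and a w :: "'n \<times> 'n \<Rightarrow> real"
    and k\<^sub>I :: real
    and Is :: "'n \<Rightarrow> real"
    and I\<^sub>L V\<^sub>r\<^sub>e\<^sub>f :: "real ^ 'n"
    and L D M :: "real ^ 'n ^ 'n"
    and F :: "real ^ 'n \<Rightarrow> real ^ 'n"
  assumes comm_graph: "pair_graph G\<^sub>c" "pverts G\<^sub>c = UNIV"
      "Digraph_Component.connected (with_proj G\<^sub>c)"
    and comm_orientation: "orientation_of O\<^sub>c G\<^sub>c"
    and comm_weights: "\<And>i j. (i, j) \<in> parcs G\<^sub>c \<Longrightarrow> a (i, j) = a (j, i)"
      "\<And>i j. (i, j) \<in> parcs G\<^sub>c \<Longrightarrow> a (i, j) > 0"
    and gain: "k\<^sub>I > 0"
    and el_graph: "pair_digraph G\<^sub>e\<^sub>l" "pverts G\<^sub>e\<^sub>l = UNIV"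
      "Digraph_Component.connected (with_proj G\<^sub>e\<^sub>l)"
    and el_weights: "\<And>e. e \<in> parcs G\<^sub>e\<^sub>l \<Longrightarrow> w e > 0"
    and scaling: "\<And>i. Is i > 0"
    and L_def: "L = k\<^sub>I *\<^sub>R laplacian O\<^sub>c a"
    and M_def: "M = laplacian G\<^sub>e\<^sub>l w"
    and D_def: "D = diag_mat (\<lambda>i. 1 / Is i)"
    and F_def: "F = consensus_field L D M I\<^sub>L V\<^sub>r\<^sub>e\<^sub>f"
  shows "(\<forall>\<Delta>V. equilibrium F \<Delta>V \<longrightarrow>
            (\<forall>i j. output_currents G\<^sub>e\<^sub>l w I\<^sub>L (\<Delta>V + V\<^sub>r\<^sub>e\<^sub>f) $ i / Is i
                 = output_currents G\<^sub>e\<^sub>l w I\<^sub>L (\<Delta>V + V\<^sub>r\<^sub>e\<^sub>f) $ j / Is j))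
       \<and> (\<exists>!\<Delta>V\<^sub>0. \<Delta>V\<^sub>0 \<in> H1 \<and> equilibrium F \<Delta>V\<^sub>0)
       \<and> (\<forall>\<Delta>V\<^sub>0 \<Delta>V. \<Delta>V\<^sub>0 \<in> H1 \<and> equilibrium F \<Delta>V\<^sub>0 \<and> equilibrium F \<Delta>V \<longrightarrow>
            (\<exists>\<alpha>. \<Delta>V = \<Delta>V\<^sub>0 + \<alpha> *\<^sub>R vec 1)
          \<and> (\<forall>\<alpha> v. \<Delta>V = \<Delta>V\<^sub>0 + \<alpha> *\<^sub>R vec 1 \<and> V\<^sub>r\<^sub>e\<^sub>f = v *\<^sub>R vec 1 \<and> \<alpha> = 0 \<longrightarrow>
               mean (\<Delta>V + V\<^sub>r\<^sub>e\<^sub>f) = v))"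
proof -
  have conn_c: "(i, j) \<in> (parcs O\<^sub>c \<union> (parcs O\<^sub>c)\<inverse>)\<^sup>*" for i j
  proof -
    \<comment> \<open>Orienting the edges does not change the symmetric closure, so connectivity
      carries over.\<close>
    have "parcs O\<^sub>c \<union> (parcs O\<^sub>c)\<inverse> = parcs G\<^sub>c \<union> (parcs G\<^sub>c)\<inverse>"
      using comm_orientation unfolding orientation_of_def by blast
    then show ?thesis
      using connected_imp_rtrancl [OF comm_graph(3,2)] by simp
  qed
  have pos_c: "a e > 0" if "e \<in> parcs O\<^sub>c" for e
    using that comm_orientation comm_weights(2) [of "fst e" "snd e"]
    by (auto simp: orientation_of_def)
  note conn_el = connected_imp_rtrancl [OF el_graph(3,2)]
  note ker_M = laplacian_mult_eq_zero_iff [of G\<^sub>e\<^sub>l w, OF conn_el el_weights, folded M_def]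
  have Is_neq: "Is i \<noteq> 0" for i
    using scaling [of i] by simp
  have sum_Is: "(\<Sum>i\<in>UNIV. Is i) > 0"
    by (simp add: scaling sum_pos)

  have equilibrium_iff: "equilibrium F x \<longleftrightarrow> (\<exists>c. I\<^sub>L + M *v (x + V\<^sub>r\<^sub>e\<^sub>f) = c *\<^sub>R (\<chi> i. Is i))" for x
  proof -
    let ?z = "I\<^sub>L + M *v (x + V\<^sub>r\<^sub>e\<^sub>f)"
    \<comment> \<open>The nonzero gain cancels, which leaves the kernel condition for the
      communication Laplacian.\<close>
    have "equilibrium F x \<longleftrightarrow> laplacian O\<^sub>c a *v (D *v ?z) = 0"
      using gain by (simp add: equilibrium_def F_def consensus_field_eq L_def
          flip: scaleR_matrix_vector_assoc)
    also have "\<dots> \<longleftrightarrow> (\<exists>c. \<forall>i. (D *v ?z) $ i = c)"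
      by (rule laplacian_mult_eq_zero_iff [OF conn_c pos_c])
    also have "\<dots> \<longleftrightarrow> (\<exists>c. ?z = c *\<^sub>R (\<chi> i. Is i))"
      using Is_neq by (simp add: D_def diag_mat_mult_component vec_eq_iff field_simps)
    finally show ?thesis .
  qed

  have sharing: "output_currents G\<^sub>e\<^sub>l w I\<^sub>L (x + V\<^sub>r\<^sub>e\<^sub>f) $ i / Is i
      = output_currents G\<^sub>e\<^sub>l w I\<^sub>L (x + V\<^sub>r\<^sub>e\<^sub>f) $ j / Is j" if "equilibrium F x" for x i j
  proof -
    obtain c where "output_currents G\<^sub>e\<^sub>l w I\<^sub>L (x + V\<^sub>r\<^sub>e\<^sub>f) = c *\<^sub>R (\<chi> i. Is i)"
      using \<open>equilibrium F x\<close> unfolding equilibrium_iff output_currents_eq M_def by blast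
    then show ?thesis
      using Is_neq by simp
  qed

  have difference: "\<exists>\<alpha>. y = x + \<alpha> *\<^sub>R vec 1" if "equilibrium F x" "equilibrium F y" for x y
  proof -
    from that obtain c d where c: "I\<^sub>L + M *v (x + V\<^sub>r\<^sub>e\<^sub>f) = c *\<^sub>R (\<chi> i. Is i)"
      and d: "I\<^sub>L + M *v (y + V\<^sub>r\<^sub>e\<^sub>f) = d *\<^sub>R (\<chi> i. Is i)"
      unfolding equilibrium_iff by blast
    have "M *v (y - x) = (I\<^sub>L + M *v (y + V\<^sub>r\<^sub>e\<^sub>f)) - (I\<^sub>L + M *v (x + V\<^sub>r\<^sub>e\<^sub>f))"
      by (simp add: matrix_vector_right_distrib matrix_vector_mult_diff_distrib)
    also have "\<dots> = (d - c) *\<^sub>R (\<chi> i. Is i)"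
      by (simp add: c d scaleR_diff_left)
    finally have Myx: "M *v (y - x) = (d - c) *\<^sub>R (\<chi> i. Is i)" .
    \<comment> \<open>The range of \<open>M\<close> has zero sum while \<open>Is\<close> has
      positive sum, so \<open>d = c\<close>.\<close>
    have "(d - c) * (\<Sum>i\<in>UNIV. Is i) = (\<Sum>i\<in>UNIV. (M *v (y - x)) $ i)"
      by (simp add: Myx sum_distrib_left)
    also have "\<dots> = 0"
      by (simp add: M_def sum_laplacian_mult)
    finally have "M *v (y - x) = 0"
      using sum_Is by (simp add: Myx)
    then obtain \<alpha> where "\<forall>i. (y - x) $ i = \<alpha>"
      using ker_M by blast
    then have "y = x + \<alpha> *\<^sub>R vec 1"
      by (simp add: vec_eq_iff algebra_simps)
    then show ?thesis ..
  qed

  have "\<exists>x. x \<in> H1 \<and> equilibrium F x"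
  proof -
    \<comment> \<open>Solving for \<open>z\<close> below needs a right-hand side of zero sum, which
      forces this ratio of total load to total scaling.\<close>
    define c where "c = (\<Sum>i\<in>UNIV. I\<^sub>L $ i) / (\<Sum>i\<in>UNIV. Is i)"
    have "(\<Sum>i\<in>UNIV. (c *\<^sub>R (\<chi> i. Is i) - I\<^sub>L) $ i) = c * (\<Sum>i\<in>UNIV. Is i) - (\<Sum>i\<in>UNIV. I\<^sub>L $ i)"
      by (simp add: sum_subtractf sum_distrib_left)
    also have "\<dots> = 0"
      using sum_Is by (simp add: c_def)
    finally obtain z where z: "M *v z = c *\<^sub>R (\<chi> i. Is i) - I\<^sub>L"
      using laplacian_surj_zero_sum [of G\<^sub>e\<^sub>l w, OF conn_el el_weights] unfolding M_def by blast
    \<comment> \<open>Since \<open>z\<close> is a voltage, the reference is subtracted to get a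
      state. Removing the mean then puts it in \<open>H1\<close>, and the constant shift is
      invisible to \<open>M\<close>.\<close>
    define x where "x = z - V\<^sub>r\<^sub>e\<^sub>f + (- mean (z - V\<^sub>r\<^sub>e\<^sub>f)) *\<^sub>R vec 1"
    have "mean x = 0"
      unfolding x_def mean_add mean_scaleR_vec_one by simp
    have "M *v vec 1 = 0"
      using ker_M by simp
    have "x + V\<^sub>r\<^sub>e\<^sub>f = z + (- mean (z - V\<^sub>r\<^sub>e\<^sub>f)) *\<^sub>R vec 1"
      by (simp add: x_def)
    then have "M *v (x + V\<^sub>r\<^sub>e\<^sub>f) = c *\<^sub>R (\<chi> i. Is i) - I\<^sub>L"
      using \<open>M *v vec 1 = 0\<close> by (simp only: matrix_vector_right_distrib matrix_vector_mult_scaleR z) simp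
    then have "equilibrium F x"
      unfolding equilibrium_iff by (intro exI [of _ c]) simp
    with \<open>mean x = 0\<close> show ?thesis
      by (auto simp: H1_def)
  qed
  moreover have "y = x" if "x \<in> H1" "equilibrium F x" "y \<in> H1" "equilibrium F y" for x y
  proof -
    obtain \<alpha> where \<alpha>: "y = x + \<alpha> *\<^sub>R vec 1"
      using difference \<open>equilibrium F x\<close> \<open>equilibrium F y\<close> by blast
    \<comment> \<open>Both means are zero, so the shift is zero.\<close>
    then have "mean y = mean x + \<alpha>"
      by (simp only: mean_add mean_scaleR_vec_one)
    with \<alpha> \<open>x \<in> H1\<close> \<open>y \<in> H1\<close> show ?thesis
      by (simp add: H1_def)
  qed
  ultimately have unique: "\<exists>!x. x \<in> H1 \<and> equilibrium F x"
    by blast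

  have balancing: "mean (y + V\<^sub>r\<^sub>e\<^sub>f) = v"
    if "x \<in> H1" "y = x + \<alpha> *\<^sub>R vec 1 \<and> V\<^sub>r\<^sub>e\<^sub>f = v *\<^sub>R vec 1 \<and> \<alpha> = 0" for x y \<alpha> v
  proof -
    \<comment> \<open>With \<alpha> zero, \<open>y\<close> is \<open>x\<close> itself, and the
      uniform reference contributes exactly \<open>v\<close>.\<close>
    have "mean (y + V\<^sub>r\<^sub>e\<^sub>f) = mean x + v"
      using that(2) by (metis mean_add mean_scaleR_vec_one add.right_neutral)
    with that(1) show ?thesis
      by (simp add: H1_def)
  qed
  show ?thesis
    using sharing unique difference balancing by blast
qed

end
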